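(* Let $N\ge 2$ and $a_c=\frac{N-2}{2}$. For $i=1,2$ let $a_i,b_i\in\mathbb{R}$ satisfy $b_i\in[a_i,a_i+1]$ if $N\ge 3$ and $b_i\in(a_i,a_i+1]$ if $N=2$, and let $p_i=\frac{2N}{N-2+2(b_i-a_i)}$. Assume $a_1+a_2=2a_c$ and $b_2-a_2=b_1-a_1$ (so $p_1=p_2$). Let $u_1,u_2$ be two nonnegative measurable functions in $\mathbb{R}^N$ satisfying $|x|^{-a_1}u_1=|x|^{-a_2}u_2$. Then $u_1$ belongs to $\mathcal{D}_{a_1,b_1}$ and is a solution of $$-\mathrm{div}(|x|^{-2a_1}\nabla u)=|x|^{-b_1p_1}|u|^{p_1-2}u\quad\text{in }\mathbb{R}^N$$ if and only if $u_2$ belongs to $\mathcal{D}_{a_2,b_2}$ and is a solution of $$-\mathrm{div}(|x|^{-2a_2}\nabla u)=|x|^{-b_2p_2}|u|^{p_2-2}u\quad\text{in }\mathbb{R}^N.$$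
   Context: For $a,b\in\mathbb{R}$ and $p=\frac{2N}{N-2+2(b-a)}$, the space $\mathcal{D}_{a,b}$ consists of the functions $u$ such that $|x|^{-b}u\in L^p(\mathbb{R}^N)$ and $|x|^{-a}\nabla u\in L^2(\mathbb{R}^N)$ ($\nabla u$ being the weak gradient, taken away from the origin), with norm given by $\|u\|^2=\||x|^{-a}\nabla u\|_{L^2(\mathbb{R}^N)}^2+\||x|^{-b}u\|_{L^p(\mathbb{R}^N)}^2$. Functions are identified when equal almost everywhere. Solutions in $\mathcal{D}_{a,b}$ are regular in $\mathbb{R}^N\setminus\{0\}$ by elliptic theory; accordingly, a solution is understood as a function which (after modification on a null set) is of class $C^2$ in $\mathbb{R}^N\setminus\{0\}$ and satisfies the equation pointwise there. *)

theory Defs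
  imports "HOL-Analysis.Analysis"
begin

text \<open>
  All notions are set up on a Euclidean space \<open>'a\<close> of dimension \<open>N = DIM('a)\<close>, with Lebesgue
  measure. Weights such as \<open>|x|\<^sup>-\<^sup>a\<close> are written \<open>norm x powr (- a)\<close>; the value \<open>0\<close> that \<open>powr\<close>
  assigns at the origin is irrelevant, since every condition below is either imposed away from
  the origin or insensitive to null sets.
\<close>

definition partial_deriv :: "'a::euclidean_space \<Rightarrow> ('a \<Rightarrow> real) \<Rightarrow> 'a \<Rightarrow> real" where
  "partial_deriv i f x = frechet_derivative f (at x) i"

definition grad :: "('a::euclidean_space \<Rightarrow> real) \<Rightarrow> 'a \<Rightarrow> 'a" where
  "grad f x = (\<Sum>i\<in>Basis. partial_deriv i f x *\<^sub>R i)"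

definition divergence :: "('a::euclidean_space \<Rightarrow> 'a) \<Rightarrow> 'a \<Rightarrow> real" where
  "divergence F x = (\<Sum>i\<in>Basis. partial_deriv i (\<lambda>y. F y \<bullet> i) x)"

text \<open>Class \<open>C\<^sup>k\<close> on an open set \<open>S\<close>.\<close>

primrec Ck_on :: "nat \<Rightarrow> ('a::euclidean_space \<Rightarrow> real) \<Rightarrow> 'a set \<Rightarrow> bool" where
  "Ck_on 0 f S \<longleftrightarrow> continuous_on S f"
| "Ck_on (Suc k) f S \<longleftrightarrow>
     (\<forall>x\<in>S. f differentiable (at x)) \<and> (\<forall>i\<in>Basis. Ck_on k (partial_deriv i f) S)"

text \<open>Test functions: \<open>C\<^sub>c\<^sup>\<infinity>(S)\<close> for open \<open>S\<close>, extended by zero to the whole space.\<close>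

definition test_fun :: "'a::euclidean_space set \<Rightarrow> ('a \<Rightarrow> real) \<Rightarrow> bool" where
  "test_fun S \<phi> \<longleftrightarrow> (\<forall>k. Ck_on k \<phi> UNIV)
     \<and> compact (closure {x. \<phi> x \<noteq> 0}) \<and> closure {x. \<phi> x \<noteq> 0} \<subseteq> S"

definition in_Lp :: "real \<Rightarrow> ('a::euclidean_space \<Rightarrow> 'b::euclidean_space) \<Rightarrow> bool" where
  "in_Lp p f \<longleftrightarrow> f \<in> borel_measurable lebesgue \<and> integrable lebesgue (\<lambda>x. norm (f x) powr p)"

definition loc_integrable_on ::
    "('a::euclidean_space \<Rightarrow> 'b::euclidean_space) \<Rightarrow> 'a set \<Rightarrow> bool" where
  "loc_integrable_on f S \<longleftrightarrow> (\<forall>K. compact K \<and> K \<subseteq> S \<longrightarrow> set_integrable lebesgue K f)"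

definition weak_gradient_on ::
    "'a::euclidean_space set \<Rightarrow> ('a \<Rightarrow> real) \<Rightarrow> ('a \<Rightarrow> 'a) \<Rightarrow> bool" where
  "weak_gradient_on S u G \<longleftrightarrow> loc_integrable_on u S \<and> loc_integrable_on G S
     \<and> (\<forall>\<phi>. test_fun S \<phi> \<longrightarrow> (\<forall>i\<in>Basis.
           (LINT x|lebesgue. u x * partial_deriv i \<phi> x) = - (LINT x|lebesgue. (G x \<bullet> i) * \<phi> x)))"

definition CKN_exponent :: "nat \<Rightarrow> real \<Rightarrow> real \<Rightarrow> real" where
  "CKN_exponent N a b = 2 * real N / (real N - 2 + 2 * (b - a))"

definition CKN_space :: "real \<Rightarrow> real \<Rightarrow> ('a::euclidean_space \<Rightarrow> real) set" where
  "CKN_space a b = {u. in_Lp (CKN_exponent DIM('a) a b) (\<lambda>x. norm x powr (- b) * u x)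
     \<and> (\<exists>G. weak_gradient_on (- {0}) u G \<and> in_Lp 2 (\<lambda>x. norm x powr (- a) *\<^sub>R G x))}"

text \<open>
  Solutions of \<open>-div(|x|\<^sup>-\<^sup>2\<^sup>a \<nabla>u) = |x|\<^sup>-\<^sup>b\<^sup>p |u|\<^sup>p\<^sup>-\<^sup>2 u\<close>: after modification on a null set, of class
  \<open>C\<^sup>2\<close> away from the origin and satisfying the equation pointwise there.
\<close>

definition CKN_solution :: "real \<Rightarrow> real \<Rightarrow> real \<Rightarrow> ('a::euclidean_space \<Rightarrow> real) \<Rightarrow> bool" where
  "CKN_solution a b p u \<longleftrightarrow> (\<exists>v. (AE x in lebesgue. v x = u x) \<and> Ck_on 2 v (- {0})
     \<and> (\<forall>x. x \<noteq> 0 \<longrightarrow>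
          - divergence (\<lambda>y. norm y powr (- 2 * a) *\<^sub>R grad v y) x
            = norm x powr (- b * p) * \<bar>v x\<bar> powr (p - 2) * v x))"

end

theory Submission
  imports Defs
begin

text \<open>
  The functions are related by \<open>u2 = |x|\<^sup>\<gamma> u1\<close> with \<open>\<gamma> = a2 - a1\<close>. Since \<open>b2 - b1 = \<gamma>\<close>, the functions
  \<open>|x|\<^bsup>-b1\<^esup> u1\<close> and \<open>|x|\<^bsup>-b2\<^esup> u2\<close> coincide, so the integrability conditions on them are the same. In
  terms of \<open>w = |x|\<^sup>-\<^sup>a u\<close> the operator \<open>u \<mapsto> -div(|x|\<^sup>-\<^sup>2\<^sup>a \<nabla>u)\<close> becomes, up to the factor \<open>|x|\<^sup>-\<^sup>a\<close>,
  \<open>-\<Delta>w + (a\<^sup>2 - (N - 2) a) |x|\<^sup>-\<^sup>2 w\<close>, whose coefficient is invariant under \<open>a \<mapsto> N - 2 - a\<close>. Hence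
  passing from \<open>u1\<close> to \<open>u2\<close> multiplies both sides of the equation by \<open>|x|\<^bsup>-\<gamma>\<^esup>\<close>
  (\<open>divergence_power_weight\<close>, \<open>nonlinearity_power_weight\<close>), and \<open>u2\<close> solves the second equation as
  soon as \<open>u1\<close> solves the first.

  What remains is the square integrability of \<open>|x|\<^bsup>-a2\<^esup> \<nabla>u2\<close>. By the product rule it would follow
  from a weighted Hardy inequality for \<open>u1\<close>. The proof below uses the equation instead:
  a solution that is \<open>C\<^sup>2\<close> away from the origin and for which \<open>|x|\<^sup>-\<^sup>b u\<close> is in \<open>L\<^sup>p\<close> automatically has
  finite energy (\<open>weighted_gradient_integrable\<close>). Indeed, let \<open>\<zeta>\<close> be a cutoff to
  \<open>\<bar>ln |x|\<bar> \<le> L\<close> that is Lipschitz with constant of order \<open>1 / L\<close> in the variable \<open>ln |x|\<close>. Testing the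
  equation with \<open>u \<zeta>\<close> bounds the energy by the \<open>L\<^sup>p\<close> integral and an error \<open>L\<^sup>-\<^sup>2 \<integral> |x|\<^bsup>-2a-2\<^esup> u\<^sup>2\<close>
  over the support of \<open>\<zeta>\<close>. By the value of \<open>p\<close>, the integrand is at most \<open>(|x|\<^sup>-\<^sup>b |u|)\<^sup>p + |x|\<^sup>-\<^sup>N\<close>
  (\<open>inverse_square_weight_le\<close>), and the integral of \<open>|x|\<^sup>-\<^sup>N\<close> over the support grows only like \<open>L\<close>
  (\<open>shell_majorant_integral\<close>); so the error stays bounded.

  The classical gradient of the \<open>C\<^sup>2\<close> representative of \<open>u2\<close> is a weak gradient away from the origin
  (\<open>classical_gradient_is_weak\<close>), which puts \<open>u2\<close> into the space belonging to \<open>a2\<close> and \<open>b2\<close>. The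
  hypotheses are symmetric in the two indices, so the same argument gives the converse.
\<close>

section \<open>Partial derivatives\<close>

lemma partial_deriv_eqI:
  "(f has_derivative f') (at x) \<Longrightarrow> partial_deriv i f x = f' i"
  unfolding partial_deriv_def by (metis frechet_derivative_at)

lemma has_partial_derivs:
  "f differentiable (at x) \<Longrightarrow> (f has_derivative (\<lambda>h. partial_deriv h f x)) (at x)"
  unfolding partial_deriv_def by (simp add: frechet_derivative_works)

lemma partial_deriv_const: "partial_deriv i (\<lambda>y. c) x = 0"
  by (rule partial_deriv_eqI) (rule has_derivative_const)

lemma partial_deriv_inner: "partial_deriv i (\<lambda>y. y \<bullet> j) x = i \<bullet> j"
  by (rule partial_deriv_eqI) (auto intro!: derivative_eq_intros)

lemma partial_deriv_add:
  assumes "f differentiable (at x)" "g differentiable (at x)"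
  shows "partial_deriv i (\<lambda>y. f y + g y) x = partial_deriv i f x + partial_deriv i g x"
  by (rule partial_deriv_eqI) (rule has_derivative_add[OF has_partial_derivs has_partial_derivs, OF assms])

lemma partial_deriv_mult:
  assumes "f differentiable (at x)" "g differentiable (at x)"
  shows "partial_deriv i (\<lambda>y. f y * g y) x = f x * partial_deriv i g x + partial_deriv i f x * g x"
  by (rule partial_deriv_eqI) (rule has_derivative_mult[OF has_partial_derivs has_partial_derivs, OF assms])

lemma differentiable_cong_open:
  assumes "open S" "x \<in> S" "\<And>y. y \<in> S \<Longrightarrow> f y = g y"
  shows "f differentiable (at x) \<longleftrightarrow> g differentiable (at x)"
  unfolding differentiable_def using assms
  by (metis has_derivative_transform_within_open)

lemma partial_deriv_cong_open:
  assumes "open S" "x \<in> S" "\<And>y. y \<in> S \<Longrightarrow> f y = g y"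
  shows "partial_deriv i f x = partial_deriv i g x"
proof -
  have "(f has_derivative f') (at x) \<longleftrightarrow> (g has_derivative f') (at x)" for f'
    using assms by (metis has_derivative_transform_within_open)
  then show ?thesis unfolding partial_deriv_def frechet_derivative_def by simp
qed

lemma has_derivative_norm_powr:
  fixes x :: "'a::euclidean_space"
  assumes "x \<noteq> 0"
  shows "((\<lambda>y. norm y powr c) has_derivative (\<lambda>h. c * norm x powr (c - 2) * (x \<bullet> h))) (at x)"
proof -
  have "norm x powr (c - 1) = norm x powr (c - 2) * norm x"
    using assms powr_mult_base[of "norm x" "c - 2"] by (simp add: mult.commute)
  moreover have "norm x powr c = norm x powr (c - 2) * (norm x)\<^sup>2"
    using assms powr_add[of "norm x" "c - 2" 2] by simp
  ultimately show ?thesis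
    using assms
    by (auto intro!: derivative_eq_intros has_derivative_norm
        simp: sgn_div_norm field_simps power2_eq_square inner_commute)
qed

lemma partial_deriv_norm_powr:
  fixes x :: "'a::euclidean_space"
  shows "x \<noteq> 0 \<Longrightarrow> partial_deriv i (\<lambda>y. norm y powr c) x = c * norm x powr (c - 2) * (x \<bullet> i)"
  by (rule partial_deriv_eqI) (rule has_derivative_norm_powr)

lemma grad_inner_Basis: "i \<in> Basis \<Longrightarrow> grad f x \<bullet> i = partial_deriv i f x"
  unfolding grad_def by (simp add: inner_sum_left inner_Basis if_distrib cong: if_cong)

lemma norm_grad_squared: "(norm (grad f x))\<^sup>2 = (\<Sum>i\<in>Basis. (partial_deriv i f x)\<^sup>2)"
  unfolding power2_norm_eq_inner
  by (subst euclidean_inner) (simp add: grad_inner_Basis power2_eq_square)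

section \<open>Functions of class \<open>C\<^sup>k\<close>\<close>

lemma Ck_on_cong:
  assumes "open S" "\<And>x. x \<in> S \<Longrightarrow> f x = g x"
  shows "Ck_on k f S \<longleftrightarrow> Ck_on k g S"
  using assms(2)
proof (induction k arbitrary: f g)
  case 0
  then show ?case by (auto cong: continuous_on_cong)
next
  case (Suc k)
  have "f differentiable (at x) \<longleftrightarrow> g differentiable (at x)" if "x \<in> S" for x
    by (rule differentiable_cong_open[OF assms(1) that Suc.prems])
  moreover have "Ck_on k (partial_deriv i f) S \<longleftrightarrow> Ck_on k (partial_deriv i g) S" for i
    by (rule Suc.IH) (rule partial_deriv_cong_open[OF assms(1) _ Suc.prems])
  ultimately show ?case by simp
qed

lemma Ck_on_SucD: "Ck_on (Suc k) f S \<Longrightarrow> Ck_on k f S"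
proof (induction k arbitrary: f)
  case 0
  then show ?case
    by (auto intro!: continuous_at_imp_continuous_on differentiable_imp_continuous_within)
next
  case (Suc k)
  then show ?case by (metis Ck_on.simps(2))
qed

lemma Ck_on_imp_continuous: "Ck_on k f S \<Longrightarrow> continuous_on S f"
  by (induction k) (auto dest: Ck_on_SucD simp del: Ck_on.simps(2))

lemma Ck_on_const: "Ck_on k (\<lambda>x. c) S"
proof (induction k arbitrary: c)
  case (Suc k)
  have "partial_deriv i (\<lambda>x. c) = (\<lambda>x. 0)" for i :: 'a
    by (rule ext) (rule partial_deriv_const)
  with Suc show ?case by simp
qed simp

lemma Ck_on_inner: "Ck_on k (\<lambda>x. x \<bullet> j) S"
proof (cases k)
  case (Suc m)
  have "partial_deriv i (\<lambda>x. x \<bullet> j) = (\<lambda>x. i \<bullet> j)" for i :: 'a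
    by (rule ext) (rule partial_deriv_inner)
  then show ?thesis unfolding Suc by (simp add: Ck_on_const inner_commute)
qed (auto intro: continuous_intros)

lemma Ck_on_add:
  assumes "open S"
  shows "Ck_on k f S \<Longrightarrow> Ck_on k g S \<Longrightarrow> Ck_on k (\<lambda>x. f x + g x) S"
proof (induction k arbitrary: f g)
  case 0
  then show ?case by (auto intro: continuous_intros)
next
  case (Suc k)
  have "Ck_on k (partial_deriv i (\<lambda>x. f x + g x)) S
      \<longleftrightarrow> Ck_on k (\<lambda>x. partial_deriv i f x + partial_deriv i g x) S" for i
    by (rule Ck_on_cong[OF assms]) (use Suc.prems in \<open>simp add: partial_deriv_add\<close>)
  with Suc show ?case by auto
qed

lemma Ck_on_mult:
  assumes "open S"
  shows "Ck_on k f S \<Longrightarrow> Ck_on k g S \<Longrightarrow> Ck_on k (\<lambda>x. f x * g x) S"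
proof (induction k arbitrary: f g)
  case 0
  then show ?case by (auto intro: continuous_intros)
next
  case (Suc k)
  have "Ck_on k f S" "Ck_on k g S"
    using Suc.prems by (blast dest: Ck_on_SucD)+
  then have "Ck_on k (\<lambda>x. f x * partial_deriv i g x + partial_deriv i f x * g x) S"
    if "i \<in> Basis" for i
    using Suc.prems that by (intro Ck_on_add[OF assms] Suc.IH) auto
  moreover have "Ck_on k (partial_deriv i (\<lambda>x. f x * g x)) S
      \<longleftrightarrow> Ck_on k (\<lambda>x. f x * partial_deriv i g x + partial_deriv i f x * g x) S" for i
    by (rule Ck_on_cong[OF assms]) (use Suc.prems in \<open>simp add: partial_deriv_mult\<close>)
  ultimately show ?case using Suc.prems by auto
qed

lemma Ck_on_norm_powr: "Ck_on k (\<lambda>x. norm x powr c) (- {0 :: 'a::euclidean_space})"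
proof (induction k arbitrary: c)
  case 0
  then show ?case by (auto intro!: continuous_intros)
next
  case (Suc k)
  have "Ck_on k (partial_deriv i (\<lambda>x::'a. norm x powr c)) (- {0})
      \<longleftrightarrow> Ck_on k (\<lambda>x. c * norm x powr (c - 2) * (x \<bullet> i)) (- {0})" for i
    by (rule Ck_on_cong) (auto simp: partial_deriv_norm_powr)
  moreover have "Ck_on k (\<lambda>x::'a. c * norm x powr (c - 2) * (x \<bullet> i)) (- {0})" for i
    by (intro Ck_on_mult Ck_on_const Ck_on_inner Suc) auto
  moreover have "(\<lambda>x::'a. norm x powr c) differentiable (at x)" if "x \<noteq> 0" for x
    using has_derivative_norm_powr[OF that] by (auto simp: differentiable_def)
  ultimately show ?case by auto
qed

section \<open>Integration by parts\<close>

lemma AE_lebesgue_nonzero: "AE x in lebesgue. x \<noteq> (0 :: 'a::euclidean_space)"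
  by (rule AE_completion) (rule AE_lborel_singleton)

lemma borel_measurable_off_origin:
  fixes f :: "'a::euclidean_space \<Rightarrow> 'b::euclidean_space"
  assumes "continuous_on (- {0}) f"
  shows "f \<in> borel_measurable lebesgue"
proof -
  have "f \<in> borel_measurable borel"
    by (rule borel_measurable_continuous_countable_exceptions[OF _ assms]) simp
  then show ?thesis by (auto intro: measurable_completion)
qed

lemma integrable_lebesgue_continuous_compact:
  fixes f :: "'a::euclidean_space \<Rightarrow> 'b::euclidean_space"
  assumes "compact K" "continuous_on K f"
  shows "integrable lebesgue (\<lambda>x. indicator K x *\<^sub>R f x)"
  using borel_integrable_compact[OF assms] by (simp add: integrable_completion)

text \<open>
  The integral of a difference quotient of \<open>g\<close> vanishes by translation invariance of the measure;
  the quotients are bounded by the mean value theorem and supported in a fixed ball, so dominated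
  convergence carries this over to the derivative. The open set \<open>S\<close> is where \<open>g\<close> is known to
  be regular: in the applications the coefficients are singular at the origin, but the support \<open>K\<close>
  avoids it.
\<close>

lemma has_integral_partial_deriv_zero:
  fixes g :: "'a::euclidean_space \<Rightarrow> real"
  assumes K: "compact K" "K \<subseteq> S" and S: "open S"
    and zero: "\<And>x. x \<notin> K \<Longrightarrow> g x = 0"
    and diff: "\<And>x. x \<in> S \<Longrightarrow> g differentiable (at x)"
    and cont: "continuous_on S (partial_deriv i g)"
    and i: "i \<in> Basis"
  shows "has_bochner_integral lebesgue (partial_deriv i g) 0"
proof -
  define dg where "dg = partial_deriv i g"
  have Kc: "open (- K)" using K by (simp add: compact_imp_closed open_Compl)
  have dg0: "dg x = 0" if "x \<notin> K" for x
    using partial_deriv_cong_open[OF Kc, of x g "\<lambda>_. 0" i] that zero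
    by (simp add: dg_def partial_deriv_const)
  have diff': "g differentiable (at x)" for x
  proof (cases "x \<in> K")
    case False
    then show ?thesis
      using differentiable_cong_open[OF Kc, of x g "\<lambda>_. 0"] zero by auto
  qed (use K diff in auto)
  have contg: "continuous_on UNIV g"
    using diff' by (simp add: continuous_at_imp_continuous_on differentiable_imp_continuous_within)
  have contdg: "continuous_on K dg"
    using cont K continuous_on_subset unfolding dg_def by blast
  obtain \<rho> where \<rho>: "K \<subseteq> cball 0 \<rho>"
    using compact_imp_bounded[OF K(1)] unfolding bounded_iff by (auto simp: subset_eq)
  obtain M where M: "\<And>x. x \<in> K \<Longrightarrow> \<bar>dg x\<bar> \<le> M"
    using compact_imp_bounded[OF compact_continuous_image[OF contdg K(1)]]
    by (auto simp: bounded_iff)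
  define C where "C = max M 0"
  have C: "\<bar>dg x\<bar> \<le> C" for x
    using M[of x] dg0[of x] unfolding C_def by (cases "x \<in> K") auto
  have intdg: "integrable lborel dg"
  proof -
    have "(\<lambda>x. indicator K x *\<^sub>R dg x) = dg" using dg0 by (auto simp: fun_eq_iff indicator_def)
    then show ?thesis using borel_integrable_compact[OF K(1) contdg] by simp
  qed
  have intg: "integrable lborel g"
  proof -
    have "(\<lambda>x. indicator K x *\<^sub>R g x) = g" using zero by (auto simp: fun_eq_iff indicator_def)
    then show ?thesis
      using borel_integrable_compact[OF K(1) continuous_on_subset[OF contg]] by simp
  qed
  have shift: "((\<lambda>t. g (x + t *\<^sub>R i)) has_real_derivative dg (x + t *\<^sub>R i)) (at t)" for x t
  proof -
    have "(g has_derivative (\<lambda>h. partial_deriv h g (x + t *\<^sub>R i))) (at (x + t *\<^sub>R i))"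
      by (rule has_partial_derivs[OF diff'])
    then have "((\<lambda>t. g (x + t *\<^sub>R i)) has_derivative
        (\<lambda>s. partial_deriv (s *\<^sub>R i) g (x + t *\<^sub>R i))) (at t)"
      by (rule has_derivative_compose[rotated]) (auto intro!: derivative_eq_intros)
    moreover have "partial_deriv (s *\<^sub>R i) g y = s * dg y" for s y
      using linear_scale[OF has_derivative_linear[OF has_partial_derivs[OF diff']], of s i y]
      by (simp add: dg_def)
    ultimately show ?thesis
      by (simp add: has_field_derivative_def mult_commute_abs)
  qed
  \<comment> \<open>The mesh is at most 1, so all difference quotients are supported in a ball of radius \<open>\<rho> + 1\<close>.\<close>
  define h where "h n = 1 / real (Suc n)" for n
  have h: "0 < h n" "h n \<le> 1" for n unfolding h_def by auto
  define q where "q n x = (g (x + h n *\<^sub>R i) - g x) / h n" for n x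
  have qbound: "norm (q n x) \<le> C * indicator (cball 0 (\<rho> + 1)) x" for n x
  proof (cases "x \<in> cball 0 (\<rho> + 1)")
    case True
    obtain z where "g (x + h n *\<^sub>R i) - g (x + 0 *\<^sub>R i) = (h n - 0) * dg (x + z *\<^sub>R i)"
      using MVT2[OF h(1)[of n], of "\<lambda>t. g (x + t *\<^sub>R i)" "\<lambda>t. dg (x + t *\<^sub>R i)"] shift by blast
    then have "q n x = dg (x + z *\<^sub>R i)" unfolding q_def using h(1)[of n] by simp
    then show ?thesis using C True by simp
  next
    case False
    have "norm (x + h n *\<^sub>R i) \<ge> norm x - h n"
      using norm_triangle_ineq4[of "x + h n *\<^sub>R i" "h n *\<^sub>R i"] h(1)[of n] i by simp
    then have "x + h n *\<^sub>R i \<notin> K" "x \<notin> K" using False \<rho> h(2)[of n] by auto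
    then show ?thesis using zero False by (simp add: q_def)
  qed
  have hlim: "h \<longlonglongrightarrow> 0" unfolding h_def using LIMSEQ_inverse_real_of_nat
    by (simp add: inverse_eq_divide)
  have qlim: "(\<lambda>n. q n x) \<longlonglongrightarrow> dg x" for x
  proof -
    have "((\<lambda>t. (g (x + t *\<^sub>R i) - g x) / t) \<longlongrightarrow> dg x) (at 0)"
      using shift[of x 0] by (simp add: DERIV_def)
    moreover have "filterlim h (at 0) sequentially"
      using hlim h(1) by (auto simp: filterlim_at intro!: always_eventually) (metis less_irrefl)
    ultimately show ?thesis unfolding q_def by (rule filterlim_compose)
  qed
  have q0: "integral\<^sup>L lborel (q n) = 0" for n
  proof -
    let ?T = "(+) (h n *\<^sub>R i) :: 'a \<Rightarrow> 'a"
    have d: "distr lborel borel ?T = lborel" by (rule lborel_distr_plus)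
    have "integrable (distr lborel borel ?T) g" using intg d by simp
    then have i1: "integrable lborel (\<lambda>x. g (x + h n *\<^sub>R i))"
      using contg by (subst (asm) integrable_distr_eq)
        (auto intro: borel_measurable_continuous_onI simp: add.commute)
    have "integral\<^sup>L (distr lborel borel ?T) g = (LINT x|lborel. g (x + h n *\<^sub>R i))"
      using contg by (subst integral_distr)
        (auto intro: borel_measurable_continuous_onI simp: add.commute)
    then have "(LINT x|lborel. g (x + h n *\<^sub>R i)) = integral\<^sup>L lborel g" using d by simp
    then show ?thesis unfolding q_def using i1 intg by simp
  qed
  have "(\<lambda>n. integral\<^sup>L lborel (q n)) \<longlonglongrightarrow> integral\<^sup>L lborel dg"
  proof (rule integral_dominated_convergence[where w = "\<lambda>x. C * indicator (cball 0 (\<rho> + 1)) x"])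
    show "q n \<in> borel_measurable lborel" for n
      unfolding q_def using contg
      by (auto intro!: borel_measurable_continuous_onI continuous_intros
          continuous_on_compose2[OF contg] simp: h_def)
    show "integrable lborel (\<lambda>x::'a. C * indicator (cball 0 (\<rho> + 1)) x)"
      by (intro integrable_mult_right integrable_real_indicator)
        (auto simp: emeasure_bounded_finite[unfolded infinity_ennreal_def])
  qed (use intdg qlim qbound in auto)
  then have "integral\<^sup>L lborel dg = 0" unfolding q0 by (simp add: LIMSEQ_const_iff)
  then have "has_bochner_integral lebesgue dg 0"
    using intdg by (simp add: has_bochner_integral_iff integrable_completion integral_completion)
  then show ?thesis by (simp add: dg_def)
qed


text \<open>
  The product of \<open>v\<close> and a test function has compact support in \<open>S\<close>, so the integral of its partial
  derivatives is zero.
\<close>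

lemma classical_gradient_is_weak:
  fixes u v :: "'a::euclidean_space \<Rightarrow> real"
  assumes S: "open S" and v: "Ck_on 1 v S"
    and u: "u \<in> borel_measurable lebesgue" and uv: "AE x in lebesgue. x \<in> S \<longrightarrow> u x = v x"
  shows "weak_gradient_on S u (grad v)"
proof -
  have contv: "continuous_on S v" using v by (rule Ck_on_imp_continuous)
  have diffv: "\<And>x. x \<in> S \<Longrightarrow> v differentiable (at x)"
    and contdv: "\<And>i. i \<in> Basis \<Longrightarrow> continuous_on S (partial_deriv i v)"
    using v by (simp_all add: eval_nat_numeral)
  have contgrad: "continuous_on S (grad v)"
    unfolding grad_def by (intro continuous_intros contdv)
  have "loc_integrable_on u S"
    unfolding loc_integrable_on_def set_integrable_def
  proof (intro allI impI)
    fix K :: "'a set" assume K: "compact K \<and> K \<subseteq> S"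
    then have "integrable lebesgue (\<lambda>x. indicator K x *\<^sub>R v x)"
      using contv continuous_on_subset by (blast intro: integrable_lebesgue_continuous_compact)
    moreover have "AE x in lebesgue. indicator K x *\<^sub>R v x = indicator K x *\<^sub>R u x"
      using uv K by (elim AE_mp) (auto simp: indicator_def)
    moreover have "K \<in> sets lebesgue" using K by (simp add: lmeasurable_compact fmeasurableD)
    ultimately show "integrable lebesgue (\<lambda>x. indicator K x *\<^sub>R u x)"
      using u by (subst integrable_cong_AE[where g = "\<lambda>x. indicator K x *\<^sub>R v x"]) auto
  qed
  moreover have "loc_integrable_on (grad v) S"
    unfolding loc_integrable_on_def set_integrable_def
    using contgrad continuous_on_subset by (blast intro: integrable_lebesgue_continuous_compact)
  moreover have "(LINT x|lebesgue. u x * partial_deriv i \<phi> x)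
      = - (LINT x|lebesgue. (grad v x \<bullet> i) * \<phi> x)"
    if \<phi>: "test_fun S \<phi>" and i: "i \<in> Basis" for \<phi> i
  proof -
    define K where "K = closure {x. \<phi> x \<noteq> 0}"
    have K: "compact K" "K \<subseteq> S" using \<phi> by (auto simp: test_fun_def K_def)
    have \<phi>0: "\<phi> x = 0" if "x \<notin> K" for x
      using that closure_subset[of "{x. \<phi> x \<noteq> 0}"] by (auto simp: K_def)
    have "Ck_on 1 \<phi> UNIV" using \<phi> by (auto simp: test_fun_def)
    then have cont\<phi>: "continuous_on UNIV \<phi>" and diff\<phi>: "\<And>x. \<phi> differentiable (at x)"
      and contd\<phi>: "continuous_on UNIV (partial_deriv i \<phi>)"
      using i Ck_on_imp_continuous[of 1 \<phi> UNIV] by (simp_all add: eval_nat_numeral)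
    have Kc: "open (- K)" using K by (simp add: compact_imp_closed open_Compl)
    have d\<phi>0: "partial_deriv i \<phi> x = 0" if "x \<notin> K" for x
      using partial_deriv_cong_open[OF Kc, of x \<phi> "\<lambda>_. 0" i] that \<phi>0
      by (simp add: partial_deriv_const)
    have i1: "integrable lebesgue (\<lambda>x. v x * partial_deriv i \<phi> x)"
    proof -
      have "continuous_on K (\<lambda>x. v x * partial_deriv i \<phi> x)"
        by (intro continuous_intros continuous_on_subset[OF contv K(2)]
            continuous_on_subset[OF contd\<phi> subset_UNIV])
      moreover have "(\<lambda>x. indicator K x *\<^sub>R (v x * partial_deriv i \<phi> x))
          = (\<lambda>x. v x * partial_deriv i \<phi> x)"
        using d\<phi>0 by (auto simp: fun_eq_iff indicator_def)
      ultimately show ?thesis using integrable_lebesgue_continuous_compact[OF K(1)] by metis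
    qed
    have i2: "integrable lebesgue (\<lambda>x. partial_deriv i v x * \<phi> x)"
    proof -
      have "continuous_on K (\<lambda>x. partial_deriv i v x * \<phi> x)"
        by (intro continuous_intros continuous_on_subset[OF contdv[OF i] K(2)]
            continuous_on_subset[OF cont\<phi> subset_UNIV])
      moreover have "(\<lambda>x. indicator K x *\<^sub>R (partial_deriv i v x * \<phi> x))
          = (\<lambda>x. partial_deriv i v x * \<phi> x)"
        using \<phi>0 by (auto simp: fun_eq_iff indicator_def)
      ultimately show ?thesis using integrable_lebesgue_continuous_compact[OF K(1)] by metis
    qed
    have prod: "partial_deriv i (\<lambda>y. v y * \<phi> y) x
        = v x * partial_deriv i \<phi> x + partial_deriv i v x * \<phi> x" for x
    proof (cases "x \<in> S")
      case True
      then show ?thesis by (rule partial_deriv_mult[OF diffv diff\<phi>])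
    next
      case False
      then have "x \<notin> K" using K by blast
      then show ?thesis
        using partial_deriv_cong_open[OF Kc, of x "\<lambda>y. v y * \<phi> y" "\<lambda>_. 0" i] \<phi>0 d\<phi>0
        by (simp add: partial_deriv_const)
    qed
    have "has_bochner_integral lebesgue (partial_deriv i (\<lambda>y. v y * \<phi> y)) 0"
    proof (rule has_integral_partial_deriv_zero[OF K S _ _ _ i])
      show "continuous_on S (partial_deriv i (\<lambda>y. v y * \<phi> y))"
        unfolding prod
        by (intro continuous_intros contv contdv[OF i] continuous_on_subset[OF contd\<phi> subset_UNIV]
            continuous_on_subset[OF cont\<phi> subset_UNIV])
    qed (use \<phi>0 diffv diff\<phi> in auto)
    then have "(LINT x|lebesgue. v x * partial_deriv i \<phi> x + partial_deriv i v x * \<phi> x) = 0"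
      unfolding prod by (simp add: has_bochner_integral_iff)
    then have "(LINT x|lebesgue. v x * partial_deriv i \<phi> x)
        = - (LINT x|lebesgue. partial_deriv i v x * \<phi> x)"
      using i1 i2 by simp
    moreover have "(LINT x|lebesgue. u x * partial_deriv i \<phi> x)
        = (LINT x|lebesgue. v x * partial_deriv i \<phi> x)"
    proof (rule integral_cong_AE)
      show "(\<lambda>x. u x * partial_deriv i \<phi> x) \<in> borel_measurable lebesgue"
        using u borel_measurable_continuous_onI[OF contd\<phi>]
        by (intro borel_measurable_times) (auto intro: measurable_completion)
      show "AE x in lebesgue. u x * partial_deriv i \<phi> x = v x * partial_deriv i \<phi> x"
        using uv K d\<phi>0 by (elim AE_mp) (rule AE_I2, metis mult_zero_right subsetD)
    qed (use i1 in auto)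
    ultimately show ?thesis using i by (simp add: grad_inner_Basis)
  qed
  ultimately show ?thesis unfolding weak_gradient_on_def by blast
qed

section \<open>Conjugating the equation by a power of the norm\<close>

lemma euclidean_sum_square: "(\<Sum>i\<in>Basis. (x \<bullet> i) * (x \<bullet> i)) = (norm (x::'a::euclidean_space))\<^sup>2"
  unfolding power2_norm_eq_inner by (subst euclidean_inner) simp

lemma Ck_on_flux:
  fixes v :: "'a::euclidean_space \<Rightarrow> real"
  assumes "Ck_on 2 v (- {0})" "i \<in> Basis"
  shows "Ck_on 1 (\<lambda>y. norm y powr c * partial_deriv i v y) (- {0})"
  using assms by (intro Ck_on_mult Ck_on_norm_powr) (auto simp: eval_nat_numeral)

lemma divergence_flux:
  fixes v :: "'a::euclidean_space \<Rightarrow> real"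
  shows "divergence (\<lambda>y. norm y powr c *\<^sub>R grad v y) x
    = (\<Sum>i\<in>Basis. partial_deriv i (\<lambda>y. norm y powr c * partial_deriv i v y) x)"
  unfolding divergence_def by (intro sum.cong refl) (simp add: grad_inner_Basis)

text \<open>
  Put \<open>\<gamma> = a2 - a1\<close>. The flux of \<open>|x|\<^sup>\<gamma> v\<close> with weight \<open>|x|\<^bsup>-2 a2\<^esup>\<close> is the flux of \<open>v\<close> with weight
  \<open>|x|\<^bsup>-2 a1\<^esup>\<close> multiplied by \<open>|x|\<^bsup>-\<gamma>\<^esup>\<close>, plus \<open>\<gamma> v |x|\<^sup>-\<^sup>N x\<close>; the exponent \<open>-N\<close> arises exactly because
  \<open>a1 + a2 = N - 2\<close>. In the divergence, the gradient of \<open>|x|\<^bsup>-\<gamma>\<^esup>\<close> cancels the gradient of \<open>v\<close> in the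
  second term, and what is left of that term vanishes since the field \<open>|x|\<^sup>-\<^sup>N x\<close> is divergence free.
\<close>

lemma divergence_power_weight:
  fixes v :: "'a::euclidean_space \<Rightarrow> real"
  assumes v: "Ck_on 2 v (- {0})" and x: "x \<noteq> 0" and a: "a1 + a2 = real DIM('a) - 2"
  shows "divergence (\<lambda>y. norm y powr (- 2 * a2) *\<^sub>R grad (\<lambda>y. norm y powr (a2 - a1) * v y) y) x
    = norm x powr (a1 - a2) * divergence (\<lambda>y. norm y powr (- 2 * a1) *\<^sub>R grad v y) x"
proof -
  define \<gamma> n where "\<gamma> = a2 - a1" and "n = real DIM('a)"
  have open0: "open (- {0::'a})" by auto
  have dv: "v differentiable (at y)" if "y \<noteq> 0" for y
    using v that by (simp add: eval_nat_numeral)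
  have dpow: "(\<lambda>y::'a. norm y powr c) differentiable (at y)" if "y \<noteq> 0" for y c
    using has_derivative_norm_powr[OF that] by (auto simp: differentiable_def)
  have r: "norm x > 0" using x by simp
  have flux: "norm y powr (- 2 * a2) * partial_deriv i (\<lambda>y. norm y powr \<gamma> * v y) y
      = norm y powr (- \<gamma>) * (norm y powr (- 2 * a1) * partial_deriv i v y)
        + \<gamma> * ((norm y powr (- n) * (y \<bullet> i)) * v y)"
    if y: "y \<in> - {0}" for y i :: 'a
  proof -
    have "norm y powr (- 2 * a2) * norm y powr \<gamma> = norm y powr (- \<gamma>) * norm y powr (- 2 * a1)"
      unfolding powr_add[symmetric] by (intro arg_cong[where f = "(powr) (norm y)"])
        (simp add: \<gamma>_def)
    moreover have "norm y powr (- 2 * a2) * norm y powr (\<gamma> - 2) = norm y powr (- n)"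
      using a unfolding powr_add[symmetric] by (intro arg_cong[where f = "(powr) (norm y)"])
        (simp add: \<gamma>_def n_def algebra_simps)
    ultimately show ?thesis
      using y by (simp add: partial_deriv_mult dv dpow partial_deriv_norm_powr algebra_simps)
  qed
  have dF: "(\<lambda>y. norm y powr (- 2 * a1) * partial_deriv i v y) differentiable (at x)"
    if "i \<in> Basis" for i
    using Ck_on_flux[OF v that] x by (simp add: eval_nat_numeral)
  have dI: "(\<lambda>y::'a. y \<bullet> i) differentiable (at x)" for i
    using Ck_on_inner[of 1 i UNIV] by (simp add: eval_nat_numeral)
  have part: "partial_deriv i (\<lambda>y. norm y powr (- 2 * a2) * partial_deriv i (\<lambda>y. norm y powr \<gamma> * v y) y) x
      = norm x powr (- \<gamma>) * partial_deriv i (\<lambda>y. norm y powr (- 2 * a1) * partial_deriv i v y) x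
        + \<gamma> * v x * norm x powr (- n - 2) * ((norm x)\<^sup>2 - n * ((x \<bullet> i) * (x \<bullet> i)))"
    if i: "i \<in> Basis" for i
  proof -
    define F where "F = (\<lambda>y. norm y powr (- 2 * a1) * partial_deriv i v y)"
    define X where "X = (\<lambda>y. norm y powr (- n) * (y \<bullet> i))"
    have diffF: "F differentiable (at x)" using dF[OF i] by (simp add: F_def)
    have diffX: "X differentiable (at x)" unfolding X_def by (intro differentiable_mult dpow dI x)
    have dX: "partial_deriv i X x
        = norm x powr (- n) - n * norm x powr (- n - 2) * (x \<bullet> i) * (x \<bullet> i)"
      using x i by (simp add: X_def partial_deriv_mult dpow dI partial_deriv_norm_powr
          partial_deriv_inner)
    have e1: "norm x powr (- \<gamma> - 2) * F x = norm x powr (- n) * partial_deriv i v x"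
    proof -
      have "norm x powr (- \<gamma> - 2) * norm x powr (- 2 * a1) = norm x powr (- n)"
        using a unfolding powr_add[symmetric] by (intro arg_cong[where f = "(powr) (norm x)"])
          (simp add: \<gamma>_def n_def algebra_simps)
      then show ?thesis by (simp add: F_def flip: mult.assoc)
    qed
    have e2: "norm x powr (- n) = norm x powr (- n - 2) * (norm x)\<^sup>2"
      using r powr_add[of "norm x" "- n - 2" 2] by simp
    have "partial_deriv i (\<lambda>y. norm y powr (- 2 * a2) * partial_deriv i (\<lambda>y. norm y powr \<gamma> * v y) y) x
        = partial_deriv i (\<lambda>y. norm y powr (- \<gamma>) * F y + \<gamma> * (X y * v y)) x"
      by (rule partial_deriv_cong_open[OF open0]) (use x flux in \<open>auto simp: F_def X_def\<close>)
    also have "\<dots> = norm x powr (- \<gamma>) * partial_deriv i F x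
        - \<gamma> * (x \<bullet> i) * (norm x powr (- \<gamma> - 2) * F x)
        + \<gamma> * (X x * partial_deriv i v x + partial_deriv i X x * v x)"
      using x by (simp add: partial_deriv_add partial_deriv_mult partial_deriv_const
          partial_deriv_norm_powr dpow diffF diffX dv differentiable_mult)
    also have "\<dots> = norm x powr (- \<gamma>) * partial_deriv i F x
        + \<gamma> * v x * (norm x powr (- n) - n * norm x powr (- n - 2) * (x \<bullet> i) * (x \<bullet> i))"
      unfolding e1 dX by (simp add: X_def algebra_simps)
    also have "\<dots> = norm x powr (- \<gamma>) * partial_deriv i F x
        + \<gamma> * v x * norm x powr (- n - 2) * ((norm x)\<^sup>2 - n * ((x \<bullet> i) * (x \<bullet> i)))"
      unfolding e2 by (simp add: algebra_simps)
    finally show ?thesis by (simp add: F_def)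
  qed
  have "(\<Sum>i\<in>Basis. (norm x)\<^sup>2 - n * ((x \<bullet> i) * (x \<bullet> i))) = 0"
    by (simp add: sum_subtractf euclidean_sum_square n_def flip: sum_distrib_left)
  then have "(\<Sum>i\<in>Basis. \<gamma> * v x * norm x powr (- n - 2) * ((norm x)\<^sup>2 - n * ((x \<bullet> i) * (x \<bullet> i)))) = 0"
    by (simp flip: sum_distrib_left)
  moreover have "divergence (\<lambda>y. norm y powr (- 2 * a2) *\<^sub>R grad (\<lambda>y. norm y powr \<gamma> * v y) y) x
      = (\<Sum>i\<in>Basis. norm x powr (- \<gamma>)
            * partial_deriv i (\<lambda>y. norm y powr (- 2 * a1) * partial_deriv i v y) x
          + \<gamma> * v x * norm x powr (- n - 2) * ((norm x)\<^sup>2 - n * ((x \<bullet> i) * (x \<bullet> i))))"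
    unfolding divergence_flux by (intro sum.cong refl part)
  ultimately show ?thesis
    unfolding divergence_flux sum_distrib_left sum.distrib by (simp add: \<gamma>_def)
qed

lemma nonlinearity_power_weight:
  fixes x :: "'a::euclidean_space"
  assumes "x \<noteq> 0" "b2 - a2 = b1 - a1"
  shows "norm x powr (- b2 * p) * \<bar>norm x powr (a2 - a1) * t\<bar> powr (p - 2) * (norm x powr (a2 - a1) * t)
    = norm x powr (a1 - a2) * (norm x powr (- b1 * p) * \<bar>t\<bar> powr (p - 2) * t)"
proof -
  have "norm x powr (- b2 * p) * (norm x powr (a2 - a1)) powr (p - 2) * norm x powr (a2 - a1)
      = norm x powr (- b2 * p + (a2 - a1) * (p - 2) + (a2 - a1))"
    unfolding powr_powr powr_add ..
  also have "- b2 * p + (a2 - a1) * (p - 2) + (a2 - a1) = (a1 - a2) + (- b1 * p)"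
  proof -
    have b2: "b2 = b1 + (a2 - a1)" using assms(2) by simp
    show ?thesis unfolding b2 by (simp add: algebra_simps)
  qed
  also have "norm x powr \<dots> = norm x powr (a1 - a2) * norm x powr (- b1 * p)"
    by (rule powr_add)
  finally show ?thesis by (simp add: abs_mult powr_mult mult_ac)
qed


section \<open>Finite energy of solutions\<close>

text \<open>
  A \<open>C\<^sup>1\<close> cutoff in the logarithmic variable \<open>ln |x|\<close>, supported where \<open>\<bar>ln |x|\<bar> \<le> L\<close>. It is a
  square because the absorption argument needs \<open>|x|\<^sup>2 |\<nabla>\<zeta>|\<^sup>2\<close> bounded by a multiple of \<open>\<zeta>\<close>, and because the
  square of the positive part is already continuously differentiable. Since \<open>ln 0 = 0\<close>, its value
  at the origin is \<open>1\<close>; it is only used multiplied by a power of \<open>norm x\<close>, which is \<open>0\<close> there.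
\<close>

definition log_cutoff :: "real \<Rightarrow> 'a::euclidean_space \<Rightarrow> real" where
  "log_cutoff L x = (max 0 (1 - (ln (norm x) / L)\<^sup>2))\<^sup>2"

lemma log_cutoff_eq_0:
  assumes "L > 0" "L \<le> \<bar>ln (norm x)\<bar>"
  shows "log_cutoff L x = 0"
proof -
  have "L\<^sup>2 \<le> (ln (norm x))\<^sup>2" using assms by (simp flip: abs_le_square_iff)
  then have "1 \<le> (ln (norm x) / L)\<^sup>2" using assms by (simp add: power_divide)
  then show ?thesis by (simp add: log_cutoff_def)
qed

lemma log_cutoff_le_1: "0 \<le> log_cutoff L x" "log_cutoff L x \<le> 1"
  unfolding log_cutoff_def by (auto intro!: power_le_one)

lemma log_cutoff_tendsto_1: "(\<lambda>n. log_cutoff (real (Suc n)) x) \<longlonglongrightarrow> 1"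
proof -
  have "(\<lambda>n. ln (norm x) * inverse (real (Suc n))) \<longlonglongrightarrow> ln (norm x) * 0"
    by (intro tendsto_intros LIMSEQ_inverse_real_of_nat)
  then have "(\<lambda>n. ln (norm x) / real (Suc n)) \<longlonglongrightarrow> 0" by (simp add: divide_inverse)
  then have "(\<lambda>n. (max 0 (1 - (ln (norm x) / real (Suc n))\<^sup>2))\<^sup>2) \<longlonglongrightarrow> (max 0 (1 - 0\<^sup>2))\<^sup>2"
    by (intro tendsto_intros)
  then show ?thesis by (simp add: log_cutoff_def)
qed

lemma has_derivative_log_cutoff:
  fixes x :: "'a::euclidean_space"
  assumes "x \<noteq> 0"
  shows "(log_cutoff L has_derivative
    (\<lambda>h. - 4 * max 0 (1 - (ln (norm x) / L)\<^sup>2) * ln (norm x) / L\<^sup>2 / (norm x)\<^sup>2 * (x \<bullet> h))) (at x)"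
proof -
  have sq: "((\<lambda>s. (max 0 s)\<^sup>2) has_real_derivative 2 * max 0 s) (at s)" for s :: real
  proof -
    consider "s < 0" | "s > 0" | "s = 0" by linarith
    then show ?thesis
    proof cases
      case 1
      have "((\<lambda>_. 0) has_real_derivative 0) (at s)" by simp
      then have "((\<lambda>s. (max 0 s)\<^sup>2) has_real_derivative 0) (at s)"
        by (rule has_field_derivative_transform_within_open[where S = "{..<0}"]) (use 1 in auto)
      then show ?thesis using 1 by simp
    next
      case 2
      have "((\<lambda>s. s\<^sup>2) has_real_derivative 2 * s) (at s)" by (auto intro!: derivative_eq_intros)
      then have "((\<lambda>s. (max 0 s)\<^sup>2) has_real_derivative 2 * s) (at s)"
        by (rule has_field_derivative_transform_within_open[where S = "{0<..}"]) (use 2 in auto)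
      then show ?thesis using 2 by simp
    next
      case 3
      have "((\<lambda>h. max 0 h) \<longlongrightarrow> max 0 0) (at (0::real))"
        by (intro tendsto_intros)
      then have "((\<lambda>h. max 0 h) \<longlongrightarrow> 0) (at (0::real))" by simp
      then have "((\<lambda>h. (max 0 h)\<^sup>2 / h) \<longlongrightarrow> 0) (at (0::real))"
        by (rule Lim_transform_eventually) (auto simp: max_def power2_eq_square eventually_at_filter)
      then show ?thesis using 3 by (simp add: DERIV_def)
    qed
  qed
  have inner: "((\<lambda>y::'a. 1 - (ln (norm y) / L)\<^sup>2) has_derivative
      (\<lambda>h. - 2 * ln (norm x) / L\<^sup>2 / (norm x)\<^sup>2 * (x \<bullet> h))) (at x)"
    using assms
    by (cases "L = 0") (auto intro!: derivative_eq_intros has_derivative_norm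
        simp: sgn_div_norm field_simps power2_eq_square inner_commute)
  have "((\<lambda>y. (max 0 (1 - (ln (norm y) / L)\<^sup>2))\<^sup>2) has_derivative
      (\<lambda>h. 2 * max 0 (1 - (ln (norm x) / L)\<^sup>2) * (- 2 * ln (norm x) / L\<^sup>2 / (norm x)\<^sup>2 * (x \<bullet> h)))) (at x)"
    by (rule has_derivative_compose[OF inner sq[THEN has_field_derivative_imp_has_derivative]])
  moreover have "log_cutoff L = (\<lambda>y::'a. (max 0 (1 - (ln (norm y) / L)\<^sup>2))\<^sup>2)"
    by (simp add: log_cutoff_def fun_eq_iff)
  ultimately show ?thesis by (simp add: mult_ac)
qed

lemma Ck_on_log_cutoff: "Ck_on 1 (log_cutoff L) (- {0 :: 'a::euclidean_space})"
proof -
  have "continuous_on (- {0}) (partial_deriv i (log_cutoff L :: 'a \<Rightarrow> real))" for i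
  proof -
    have "continuous_on (- {0}) (\<lambda>x::'a. - 4 * max 0 (1 - (ln (norm x) / L)\<^sup>2) * ln (norm x) / L\<^sup>2
        / (norm x)\<^sup>2 * (x \<bullet> i))"
      by (cases "L = 0") (auto intro!: continuous_intros)
    then show ?thesis
      by (rule continuous_on_eq) (simp add: partial_deriv_eqI[OF has_derivative_log_cutoff])
  qed
  then show ?thesis
    using has_derivative_log_cutoff by (auto simp: eval_nat_numeral differentiable_def)
qed

text \<open>
  The cross term of the energy identity. With \<open>\<zeta> = m\<^sup>2\<close> one has
  \<open>|\<nabla>\<zeta>| \<le> 4 m / (L |x|)\<close>, so that Young's inequality puts half of \<open>\<zeta> |g|\<^sup>2\<close> on one side and leaves a
  remainder in which \<open>g\<close> no longer occurs.
\<close>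

lemma cutoff_gradient_absorption:
  fixes x g :: "'a::euclidean_space" and L t :: real
  assumes x: "x \<noteq> 0" and L: "L > 0"
  shows "\<bar>t * (\<Sum>i\<in>Basis. (g \<bullet> i) * partial_deriv i (log_cutoff L) x)\<bar>
    \<le> log_cutoff L x * (norm g)\<^sup>2 / 2 + 8 / L\<^sup>2 * (t\<^sup>2 / (norm x)\<^sup>2 * of_bool (\<bar>ln (norm x)\<bar> \<le> L))"
proof -
  define m where "m = max 0 (1 - (ln (norm x) / L)\<^sup>2)"
  define s where "s = ln (norm x)"
  define r where "r = norm x"
  have r: "r > 0" using x by (simp add: r_def)
  have sum: "(\<Sum>i\<in>Basis. (g \<bullet> i) * partial_deriv i (log_cutoff L) x)
      = - 4 * m * s / L\<^sup>2 / r\<^sup>2 * (g \<bullet> x)"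
    unfolding euclidean_inner[of g x] sum_distrib_left
    by (intro sum.cong refl)
      (simp add: partial_deriv_eqI[OF has_derivative_log_cutoff[OF x]] m_def s_def r_def)
  show ?thesis
  proof (cases "\<bar>s\<bar> \<le> L")
    case False
    then have "(ln (norm x) / L)\<^sup>2 > 1"
      using L by (simp add: s_def power_divide abs_le_square_iff[symmetric] flip: not_le)
    then have "m = 0" by (simp add: m_def)
    then show ?thesis unfolding sum using False by (simp add: s_def log_cutoff_def)
  next
    case True
    have "m \<ge> 0" by (simp add: m_def)
    have "\<bar>t * (- 4 * m * s / L\<^sup>2 / r\<^sup>2 * (g \<bullet> x))\<bar> = \<bar>t\<bar> * (4 * m / L\<^sup>2 / r\<^sup>2) * (\<bar>s\<bar> * \<bar>g \<bullet> x\<bar>)"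
      using \<open>m \<ge> 0\<close> by (simp add: abs_mult)
    also have "\<dots> \<le> \<bar>t\<bar> * (4 * m / L\<^sup>2 / r\<^sup>2) * (L * (norm g * r))"
      using True Cauchy_Schwarz_ineq2[of g x] \<open>m \<ge> 0\<close> L
      by (intro mult_left_mono mult_mono) (auto simp: r_def)
    also have "\<dots> = (m * norm g) * (4 * \<bar>t\<bar> / (L * r))"
      using r L by (simp add: field_simps power2_eq_square)
    also have "\<dots> \<le> (m * norm g)\<^sup>2 / 2 + (4 * \<bar>t\<bar> / (L * r))\<^sup>2 / 2"
      using sum_squares_bound[of "m * norm g" "4 * \<bar>t\<bar> / (L * r)"] by simp
    also have "\<dots> = log_cutoff L x * (norm g)\<^sup>2 / 2 + 8 / L\<^sup>2 * (t\<^sup>2 / (norm x)\<^sup>2)"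
      by (simp add: log_cutoff_def m_def r_def power_mult_distrib power_divide)
    finally show ?thesis unfolding sum using True by (simp add: s_def)
  qed
qed

text \<open>
  Young's inequality for the product of \<open>(r\<^sup>-\<^sup>b |t|)\<^sup>2\<close> and \<open>r\<^bsup>2 (b - a - 1)\<^esup>\<close> with exponents \<open>p / 2\<close> and
  \<open>p / (p - 2)\<close>: the second factor raised to the conjugate exponent is exactly \<open>r\<^sup>-\<^sup>n\<close>, by the
  choice of \<open>p\<close>. Comparing \<open>r\<^sup>-\<^sup>b |t|\<close> with \<open>r\<^bsup>- n / p\<^esup>\<close> instead of quoting Young's inequality covers the
  case \<open>p = 2\<close>, where the conjugate exponent is infinite.
\<close>

lemma inverse_square_weight_le:
  fixes r t a b p n :: real
  assumes r: "r > 0" and pos: "0 < n - 2 + 2 * (b - a)" and ba: "b - a \<le> 1"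
    and p: "p = 2 * n / (n - 2 + 2 * (b - a))" and n: "n > 0"
  shows "r powr (- 2 * a) * t\<^sup>2 / r\<^sup>2 \<le> \<bar>r powr (- b) * t\<bar> powr p + r powr (- n)"
proof -
  define f where "f = \<bar>r powr (- b) * t\<bar>"
  have p2: "p \<ge> 2" and p0: "p > 0" using pos ba n by (auto simp: p field_simps)
  have np: "n / p = (n - 2) / 2 + (b - a)" using pos n by (simp add: p field_simps)
  have lhs: "r powr (- 2 * a) * t\<^sup>2 / r\<^sup>2 = f\<^sup>2 * r powr (2 * (b - a - 1))"
  proof -
    have "f\<^sup>2 * r powr (2 * (b - a - 1)) = t\<^sup>2 * (r powr (- b) * r powr (- b) * r powr (2 * (b - a - 1)))"
      by (simp add: f_def power_mult_distrib power2_eq_square)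
    also have "r powr (- b) * r powr (- b) * r powr (2 * (b - a - 1)) = r powr (- 2 * a) * r powr (- 2)"
      unfolding powr_add[symmetric] by (intro arg_cong[where f = "(powr) r"]) (simp add: algebra_simps)
    also have "r powr (- 2) = 1 / r\<^sup>2" using r by (simp add: powr_minus_divide)
    finally show ?thesis by simp
  qed
  show ?thesis
  proof (cases "f \<ge> r powr (- n / p)")
    case True
    have "f\<^sup>2 * r powr (2 * (b - a - 1)) = f\<^sup>2 * (r powr (- n / p)) powr (p - 2)"
    proof -
      have "(- n / p) * (p - 2) = - n + 2 * (n / p)" using p0 by (simp add: field_simps)
      also have "\<dots> = 2 * (b - a - 1)" unfolding np by (simp add: field_simps)
      finally show ?thesis by (simp add: powr_powr)
    qed
    also have "\<dots> \<le> f\<^sup>2 * f powr (p - 2)"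
      using True p2 by (intro mult_left_mono powr_mono2) auto
    also have "\<dots> = f powr p"
    proof -
      have "0 < f" using True r by (simp add: less_le_trans[of 0 "r powr (- n / p)"])
      then show ?thesis using powr_add[of f 2 "p - 2"] by simp
    qed
    finally show ?thesis unfolding lhs by (simp add: f_def add_increasing2)
  next
    case False
    have "f\<^sup>2 \<le> (r powr (- n / p))\<^sup>2"
      using False by (intro power_mono) (auto simp: f_def)
    then have "f\<^sup>2 * r powr (2 * (b - a - 1)) \<le> (r powr (- n / p))\<^sup>2 * r powr (2 * (b - a - 1))"
      by (intro mult_right_mono) auto
    also have "\<dots> = r powr (- n)"
      unfolding power2_eq_square powr_add[symmetric] using np
      by (intro arg_cong[where f = "(powr) r"]) simp
    finally show ?thesis unfolding lhs by (simp add: f_def add_increasing)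
  qed
qed

text \<open>
  The measure \<open>|x|\<^sup>-\<^sup>N dx\<close> is invariant under dilations, so the integral of \<open>|x|\<^sup>-\<^sup>N\<close> over each
  shell \<open>e\<^sup>k \<le> |x| < e\<^sup>k\<^sup>+\<^sup>1\<close> is the same constant. Replacing each shell by the ball that
  contains it gives a majorant of \<open>|x|\<^sup>-\<^sup>N\<close> on the support of the cutoff whose integral grows only
  linearly in the logarithmic size \<open>m\<close>, and makes polar coordinates superfluous.
\<close>

definition shell_majorant :: "nat \<Rightarrow> 'a::euclidean_space \<Rightarrow> real" where
  "shell_majorant m x = (\<Sum>k\<in>{- int m..int m}.
     exp (- real DIM('a) * real_of_int k) * indicator (ball 0 (exp (real_of_int k + 1))) x)"

lemma shell_majorant_bound:
  fixes x :: "'a::euclidean_space"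
  assumes "x \<noteq> 0" "\<bar>ln (norm x)\<bar> \<le> real m"
  shows "norm x powr (- real DIM('a)) \<le> shell_majorant m x"
proof -
  define k where "k = \<lfloor>ln (norm x)\<rfloor>"
  have k: "k \<in> {- int m..int m}" using assms(2) unfolding k_def by (auto; linarith)
  have "real_of_int k \<le> ln (norm x)" "ln (norm x) < real_of_int k + 1" unfolding k_def by linarith+
  then have r: "norm x < exp (real_of_int k + 1)" "real_of_int k \<le> ln (norm x)"
    using assms(1) by (metis exp_less_mono exp_ln zero_less_norm_iff, simp)
  have "norm x powr (- real DIM('a)) = exp (- real DIM('a) * ln (norm x))"
    using assms(1) by (simp add: powr_def)
  also have "\<dots> \<le> exp (- real DIM('a) * real_of_int k)" using r by simp
  also have "\<dots> = exp (- real DIM('a) * real_of_int k) * indicator (ball 0 (exp (real_of_int k + 1))) x"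
    using r by simp
  also have "\<dots> \<le> shell_majorant m x"
    unfolding shell_majorant_def
    by (rule member_le_sum[OF k, where f = "\<lambda>k. exp (- real DIM('a) * real_of_int k)
          * indicator (ball 0 (exp (real_of_int k + 1))) x"]) auto
  finally show ?thesis .
qed

lemma shell_majorant_integral:
  "has_bochner_integral lebesgue (shell_majorant m :: 'a::euclidean_space \<Rightarrow> real)
    ((2 * real m + 1) * (exp (real DIM('a)) * measure lborel (ball (0 :: 'a) 1)))"
proof -
  have "has_bochner_integral lebesgue (\<lambda>x::'a. exp (- real DIM('a) * real_of_int k)
      * indicator (ball 0 (exp (real_of_int k + 1))) x)
      (exp (real DIM('a)) * measure lborel (ball (0 :: 'a) 1))" for k :: int
  proof -
    have "has_bochner_integral lebesgue (indicator (ball (0::'a) (exp (real_of_int k + 1))) :: 'a \<Rightarrow> real)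
        (measure lebesgue (ball (0::'a) (exp (real_of_int k + 1))))"
      by (intro has_bochner_integral_real_indicator)
        (auto simp: emeasure_bounded_finite[unfolded infinity_ennreal_def])
    moreover have "measure lebesgue (ball (0::'a) (exp (real_of_int k + 1)))
        = exp (real DIM('a) * (real_of_int k + 1)) * measure lborel (ball (0 :: 'a) 1)"
      using content_ball_conv_unit_ball[of "exp (real_of_int k + 1)" "0::'a"]
      by (simp add: exp_of_nat_mult)
    ultimately have "has_bochner_integral lebesgue (\<lambda>x::'a. exp (- real DIM('a) * real_of_int k)
      * indicator (ball 0 (exp (real_of_int k + 1))) x)
      (exp (- real DIM('a) * real_of_int k)
        * (exp (real DIM('a) * (real_of_int k + 1)) * measure lborel (ball (0 :: 'a) 1)))"
      by (intro has_bochner_integral_mult_right) simp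
    then show ?thesis by (simp add: algebra_simps flip: exp_add mult.assoc)
  qed
  then have "has_bochner_integral lebesgue (shell_majorant m :: 'a \<Rightarrow> real)
     (\<Sum>k\<in>{- int m..int m}. exp (real DIM('a)) * measure lborel (ball (0 :: 'a) 1))"
    unfolding shell_majorant_def[abs_def] by (rule has_bochner_integral_sum)
  then show ?thesis by simp
qed


text \<open>
  A Caccioppoli estimate. Testing the equation with \<open>v \<zeta>\<close> for a logarithmic cutoff \<open>\<zeta>\<close> and
  absorbing the cross term gives
  \<open>\<integral> \<zeta> |x|\<^sup>-\<^sup>2\<^sup>a |\<nabla>v|\<^sup>2 \<le> 2 \<integral> |x|\<^sup>-\<^sup>b\<^sup>p |v|\<^sup>p + (16 / L\<^sup>2) \<integral> |x|\<^sup>-\<^sup>2\<^sup>a v\<^sup>2 |x|\<^sup>-\<^sup>2\<close>,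
  the last integral being over \<open>\<bar>ln |x|\<bar> \<le> L\<close>. That integral is at most \<open>\<integral> |x|\<^sup>-\<^sup>b\<^sup>p |v|\<^sup>p\<close> plus a
  constant times \<open>2 L + 1\<close>, so the right-hand side stays bounded as \<open>L\<close> tends to infinity.
  Thus for solutions the integrability of the gradient is a consequence of that of the function.
\<close>

lemma weighted_gradient_integrable:
  fixes v :: "'a::euclidean_space \<Rightarrow> real"
  assumes v: "Ck_on 2 v (- {0})"
    and eq: "\<And>x. x \<noteq> 0 \<Longrightarrow> - divergence (\<lambda>y. norm y powr (- 2 * a) *\<^sub>R grad v y) x
        = norm x powr (- b * p) * \<bar>v x\<bar> powr (p - 2) * v x"
    and Lp: "integrable lebesgue (\<lambda>x. \<bar>norm x powr (- b) * v x\<bar> powr p)"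
    and pos: "0 < real DIM('a) - 2 + 2 * (b - a)" and ba: "b - a \<le> 1"
    and p: "p = CKN_exponent DIM('a) a b"
  shows "integrable lebesgue (\<lambda>x. norm x powr (- 2 * a) * (norm (grad v x))\<^sup>2)"
proof -
  define W where "W x = norm x powr (- 2 * a) * (norm (grad v x))\<^sup>2" for x
  define f where "f x = \<bar>norm x powr (- b) * v x\<bar> powr p" for x
  define I where "I = integral\<^sup>L lebesgue f"
  define C where "C = exp (real DIM('a)) * measure lborel (ball (0 :: 'a) 1)"
  define F where "F i y = norm y powr (- 2 * a) * partial_deriv i v y" for i y
  have n: "real DIM('a) > 0" by simp
  have open0: "open (- {0::'a})" by auto
  have I0: "I \<ge> 0" unfolding I_def f_def by (intro integral_nonneg_AE) auto
  have C0: "C \<ge> 0" by (simp add: C_def)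
  have f: "has_bochner_integral lebesgue f I"
    using Lp by (simp add: has_bochner_integral_iff I_def f_def[abs_def])
  have v1: "Ck_on 1 v (- {0})" using v Ck_on_SucD[of 1 v] by (simp add: numeral_2_eq_2)
  have F1: "Ck_on 1 (F i) (- {0})" if "i \<in> Basis" for i
    using Ck_on_flux[OF v that] by (simp add: F_def[abs_def])
  have contgrad: "continuous_on (- {0}) (grad v)"
    unfolding grad_def using v1 by (intro continuous_intros) (simp add: eval_nat_numeral)
  have Wmeas: "W \<in> borel_measurable lebesgue"
    unfolding W_def[abs_def] using contgrad
    by (intro borel_measurable_off_origin) (auto intro!: continuous_intros)
  have W0: "W x \<ge> 0" for x by (simp add: W_def)
  define u where "u m x = log_cutoff (real (Suc m)) x * W x" for m x
  have bound: "(\<integral>\<^sup>+x. ennreal (u m x) \<partial>lebesgue) \<le> ennreal (18 * I + 48 * C)" for m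
  proof -
    define L where "L = real (Suc m)"
    have L: "L \<ge> 1" by (simp add: L_def)
    let ?\<zeta> = "log_cutoff L :: 'a \<Rightarrow> real"
    define g where "g i = (\<lambda>y. F i y * (v y * ?\<zeta> y))" for i
    define T where "T x = (\<Sum>i\<in>Basis. partial_deriv i (g i) x)" for x
    have g1: "Ck_on 1 (g i) (- {0})" if "i \<in> Basis" for i
      unfolding g_def by (intro Ck_on_mult open0 F1 that v1 Ck_on_log_cutoff)
    have "has_bochner_integral lebesgue (partial_deriv i (g i)) 0" if i: "i \<in> Basis" for i
    proof (rule has_integral_partial_deriv_zero[OF _ _ open0 _ _ _ i])
      let ?K = "cball (0::'a) (exp L) - ball 0 (exp (- L))"
      show "compact ?K" by (intro compact_diff) auto
      show "?K \<subseteq> - {0}" by auto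
      show "g i x = 0" if x: "x \<notin> ?K" for x
      proof (cases "x = 0")
        case True
        \<comment> \<open>Here the weight vanishes, since \<open>0 powr c = 0\<close>, although the cutoff does not.\<close>
        then show ?thesis by (simp add: g_def F_def)
      next
        case False
        have "norm x > exp L \<or> norm x < exp (- L)" using x by auto
        then have "L \<le> \<bar>ln (norm x)\<bar>"
          using False ln_less_cancel_iff[of "exp L" "norm x"] ln_less_cancel_iff[of "norm x" "exp (- L)"]
          by auto
        then show ?thesis using log_cutoff_eq_0[of L x] L by (simp add: g_def)
      qed
    qed (use g1[OF i] i in \<open>auto simp: eval_nat_numeral\<close>)
    then have T: "has_bochner_integral lebesgue T 0"
      using has_bochner_integral_sum[of Basis lebesgue "\<lambda>i. partial_deriv i (g i)" "\<lambda>_. 0"]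
      by (simp add: T_def[abs_def])
    \<comment> \<open>The integral of \<open>T\<close> vanishes, so that of \<open>R\<close> has a bound that does not depend on \<open>L\<close>.\<close>
    define R where "R x = 2 * T x + 2 * f x + 16 / L\<^sup>2 * (f x + shell_majorant (Suc m) x)" for x
    have R: "has_bochner_integral lebesgue R
        (2 * 0 + 2 * I + 16 / L\<^sup>2 * (I + (2 * L + 1) * C))"
      unfolding R_def[abs_def] L_def C_def
      by (intro has_bochner_integral_add has_bochner_integral_mult_right T f
          shell_majorant_integral impI)
    have pointwise: "u m x \<le> R x" if x: "x \<noteq> 0" for x
    proof -
      define X where "X = v x * (\<Sum>i\<in>Basis. (grad v x \<bullet> i) * partial_deriv i ?\<zeta> x)"
      have diff: "F i differentiable (at x)" "v differentiable (at x)" "?\<zeta> differentiable (at x)"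
        if "i \<in> Basis" for i
        using F1[OF that] v1 Ck_on_log_cutoff[of L, where ?'a = 'a] x by (simp_all add: eval_nat_numeral)
      have "T x = (\<Sum>i\<in>Basis. v x * ?\<zeta> x * partial_deriv i (F i) x
          + (?\<zeta> x * norm x powr (- 2 * a) * (partial_deriv i v x)\<^sup>2
            + norm x powr (- 2 * a) * (v x * ((grad v x \<bullet> i) * partial_deriv i ?\<zeta> x))))"
        unfolding T_def g_def
        by (intro sum.cong refl)
          (simp add: partial_deriv_mult diff differentiable_mult, simp add: F_def grad_inner_Basis
            power2_eq_square algebra_simps)
      also have "\<dots> = v x * ?\<zeta> x * (\<Sum>i\<in>Basis. partial_deriv i (F i) x)
          + (?\<zeta> x * norm x powr (- 2 * a) * (\<Sum>i\<in>Basis. (partial_deriv i v x)\<^sup>2)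
            + norm x powr (- 2 * a) * X)"
        by (simp only: sum.distrib sum_distrib_left X_def)
      also have "(\<Sum>i\<in>Basis. partial_deriv i (F i) x)
          = - (norm x powr (- b * p) * \<bar>v x\<bar> powr (p - 2) * v x)"
        using eq[OF x] unfolding divergence_flux by (simp add: F_def[abs_def])
      also have "v x * ?\<zeta> x * - (norm x powr (- b * p) * \<bar>v x\<bar> powr (p - 2) * v x) = - (?\<zeta> x * f x)"
      proof -
        have "\<bar>v x\<bar> powr (p - 2) * (v x * v x) = \<bar>v x\<bar> powr p"
          using powr_add[of "\<bar>v x\<bar>" "p - 2" 2] by (cases "v x = 0") (auto simp: power2_eq_square)
        moreover have "f x = norm x powr (- b * p) * \<bar>v x\<bar> powr p"
          by (simp add: f_def abs_mult powr_mult powr_powr)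
        ultimately show ?thesis by (metis (no_types, lifting) mult.assoc mult.commute mult_minus_right)
      qed
      finally have T_eq: "u m x = T x + ?\<zeta> x * f x - norm x powr (- 2 * a) * X"
        by (simp add: u_def W_def L_def norm_grad_squared)
      have f0: "f x \<ge> 0" by (simp add: f_def)
      have "- (norm x powr (- 2 * a) * X) \<le> norm x powr (- 2 * a) * \<bar>X\<bar>"
        by (metis abs_ge_minus_self mult_left_mono mult_minus_right powr_ge_zero)
      also have "\<dots> \<le> norm x powr (- 2 * a) * (?\<zeta> x * (norm (grad v x))\<^sup>2 / 2
          + 8 / L\<^sup>2 * ((v x)\<^sup>2 / (norm x)\<^sup>2 * of_bool (\<bar>ln (norm x)\<bar> \<le> L)))"
        unfolding X_def using L by (intro mult_left_mono cutoff_gradient_absorption x) auto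
      also have "\<dots> = u m x / 2 + 8 / L\<^sup>2
          * (norm x powr (- 2 * a) * (v x)\<^sup>2 / (norm x)\<^sup>2 * of_bool (\<bar>ln (norm x)\<bar> \<le> L))"
        by (simp add: u_def W_def L_def algebra_simps)
      also have "\<dots> \<le> u m x / 2 + 8 / L\<^sup>2 * (f x + shell_majorant (Suc m) x)"
      proof -
        have "norm x powr (- 2 * a) * (v x)\<^sup>2 / (norm x)\<^sup>2 \<le> f x + norm x powr (- real DIM('a))"
          unfolding f_def using inverse_square_weight_le[of "norm x" "real DIM('a)" b a p "v x"] x pos ba n p
          by (simp add: CKN_exponent_def)
        moreover have "norm x powr (- real DIM('a)) \<le> shell_majorant (Suc m) x"
          if "\<bar>ln (norm x)\<bar> \<le> L" using shell_majorant_bound[OF x] that unfolding L_def .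
        moreover have "shell_majorant (Suc m) x \<ge> 0"
          unfolding shell_majorant_def by (intro sum_nonneg) auto
        ultimately have "norm x powr (- 2 * a) * (v x)\<^sup>2 / (norm x)\<^sup>2 * of_bool (\<bar>ln (norm x)\<bar> \<le> L)
            \<le> f x + shell_majorant (Suc m) x" using f0 by auto
        then show ?thesis by (intro add_left_mono mult_left_mono) auto
      qed
      finally have "- (norm x powr (- 2 * a) * X)
          \<le> u m x / 2 + 8 / L\<^sup>2 * (f x + shell_majorant (Suc m) x)" .
      moreover have "?\<zeta> x * f x \<le> f x"
        using log_cutoff_le_1[of L x] f0 by (simp add: mult_left_le_one_le)
      moreover have "16 / L\<^sup>2 * (f x + shell_majorant (Suc m) x)
          = 2 * (8 / L\<^sup>2 * (f x + shell_majorant (Suc m) x))" by simp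
      ultimately show ?thesis using T_eq unfolding R_def by linarith
    qed
    have u0: "u m x \<ge> 0" for x unfolding u_def by (intro mult_nonneg_nonneg log_cutoff_le_1 W0)
    have R0: "AE x in lebesgue. R x \<ge> 0"
      using AE_lebesgue_nonzero by eventually_elim (rule order_trans[OF u0 pointwise])
    have "(\<integral>\<^sup>+x. ennreal (u m x) \<partial>lebesgue) \<le> (\<integral>\<^sup>+x. ennreal (R x) \<partial>lebesgue)"
    proof (rule nn_integral_mono_AE)
      show "AE x in lebesgue. ennreal (u m x) \<le> ennreal (R x)"
        using AE_lebesgue_nonzero by eventually_elim (intro ennreal_leI pointwise)
    qed
    also have "\<dots> = ennreal (2 * I + 16 / L\<^sup>2 * (I + (2 * L + 1) * C))"
      using R R0 by (simp add: nn_integral_eq_integral has_bochner_integral_iff)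
    also have "\<dots> \<le> ennreal (18 * I + 48 * C)"
    proof (rule ennreal_leI)
      have L2: "1 \<le> L\<^sup>2" "L \<le> L\<^sup>2" using L by (auto simp: self_le_power)
      have "I / L\<^sup>2 \<le> I" using I0 L2 by (simp add: divide_le_eq mult_le_cancel_left1)
      moreover have "(2 * L + 1) / L\<^sup>2 \<le> 3" using L2 L by (simp add: divide_le_eq)
      then have "(2 * L + 1) / L\<^sup>2 * C \<le> 3 * C" using C0 by (rule mult_right_mono)
      ultimately show "2 * I + 16 / L\<^sup>2 * (I + (2 * L + 1) * C) \<le> 18 * I + 48 * C"
        by (simp add: distrib_left)
    qed
    finally show ?thesis .
  qed
  have umeas: "u m \<in> borel_measurable lebesgue" for m
    unfolding u_def
    by (intro borel_measurable_times Wmeas borel_measurable_off_origin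
        Ck_on_imp_continuous[OF Ck_on_log_cutoff])
  have "(\<lambda>m. ennreal (u m x)) \<longlonglongrightarrow> ennreal (W x)" for x
    using tendsto_mult[OF log_cutoff_tendsto_1 tendsto_const[of "W x"]]
    unfolding u_def by (intro tendsto_ennrealI) (simp only: mult_1_left)
  then have "ennreal (W x) = liminf (\<lambda>m. ennreal (u m x))" for x
    by (metis lim_imp_Liminf trivial_limit_sequentially)
  then have "(\<integral>\<^sup>+x. ennreal (W x) \<partial>lebesgue) \<le> liminf (\<lambda>m. \<integral>\<^sup>+x. ennreal (u m x) \<partial>lebesgue)"
    using umeas by (simp add: nn_integral_liminf)
  also have "\<dots> \<le> liminf (\<lambda>m. ennreal (18 * I + 48 * C))"
    using bound by (intro Liminf_mono) auto
  also have "\<dots> < \<infinity>" by (simp add: Liminf_const)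
  finally have "integrable lebesgue W"
    using Wmeas W0 by (intro integrableI_nonneg) auto
  then show ?thesis by (simp add: W_def[abs_def])
qed

section \<open>The correspondence between the two problems\<close>

text \<open>
  The integrability of \<open>|x|\<^sup>-\<^sup>b u\<close> and the equation carry over exactly. The gradient condition does
  not carry over term by term, because \<open>\<nabla>(|x|\<^sup>\<gamma> u)\<close> contains the term \<open>\<gamma> |x|\<^bsup>\<gamma> - 2\<^esup> u x\<close>; it is
  recovered from the equation that the transformed function satisfies.
\<close>

lemma CKN_solution_power_weight:
  fixes u1 u2 :: "'a::euclidean_space \<Rightarrow> real"
  assumes pos: "0 < real DIM('a) - 2 + 2 * (b1 - a1)" and ba: "b1 - a1 \<le> 1"
    and a: "a1 + a2 = real DIM('a) - 2" and b: "b2 - a2 = b1 - a1"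
    and p: "p = CKN_exponent DIM('a) a1 b1"
    and u2: "u2 \<in> borel_measurable lebesgue"
    and u12: "AE x in lebesgue. norm x powr (- a1) * u1 x = norm x powr (- a2) * u2 x"
    and space: "u1 \<in> CKN_space a1 b1" and sol: "CKN_solution a1 b1 p u1"
  shows "u2 \<in> CKN_space a2 b2 \<and> CKN_solution a2 b2 p u2"
proof -
  obtain v1 where v1u1: "AE x in lebesgue. v1 x = u1 x" and v1: "Ck_on 2 v1 (- {0})"
    and eq1: "\<And>x. x \<noteq> 0 \<Longrightarrow> - divergence (\<lambda>y. norm y powr (- 2 * a1) *\<^sub>R grad v1 y) x
        = norm x powr (- b1 * p) * \<bar>v1 x\<bar> powr (p - 2) * v1 x"
    using sol unfolding CKN_solution_def by blast
  define v2 where "v2 = (\<lambda>x. norm x powr (a2 - a1) * v1 x)"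
  have p2: "p = CKN_exponent DIM('a) a2 b2" using p b by (simp add: CKN_exponent_def)
  have v2: "Ck_on 2 v2 (- {0})"
    unfolding v2_def by (intro Ck_on_mult Ck_on_norm_powr v1) auto
  then have v2': "Ck_on 1 v2 (- {0})" using Ck_on_SucD[of 1 v2] by (simp add: numeral_2_eq_2)
  have eq2: "- divergence (\<lambda>y. norm y powr (- 2 * a2) *\<^sub>R grad v2 y) x
      = norm x powr (- b2 * p) * \<bar>v2 x\<bar> powr (p - 2) * v2 x" if x: "x \<noteq> 0" for x
    unfolding v2_def divergence_power_weight[OF v1 x a] nonlinearity_power_weight[OF x b]
    using arg_cong[OF eq1[OF x], of "(*) (norm x powr (a1 - a2))"] by simp
  have u2v1: "AE x in lebesgue. x \<noteq> 0 \<and> u2 x = norm x powr (a2 - a1) * u1 x \<and> v1 x = u1 x"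
    using AE_lebesgue_nonzero u12 v1u1
  proof eventually_elim
    case (elim x)
    have "norm x powr (a2 - a1) * u1 x = norm x powr a2 * (norm x powr (- a1) * u1 x)"
      by (simp add: mult.assoc[symmetric] powr_add[symmetric])
    also have "\<dots> = norm x powr a2 * norm x powr (- a2) * u2 x"
      using elim by simp
    also have "\<dots> = u2 x"
      using elim unfolding powr_add[symmetric] by simp
    finally have "norm x powr (a2 - a1) * u1 x = u2 x" .
    then show ?case using elim by simp
  qed
  then have u2v2: "AE x in lebesgue. v2 x = u2 x"
    by eventually_elim (simp add: v2_def)
  have w: "AE x in lebesgue. norm x powr (- b2) * u2 x = norm x powr (- b1) * u1 x"
    using u2v1
  proof eventually_elim
    case (elim x)
    have "- b2 + (a2 - a1) = - b1" using b by simp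
    then show ?case using elim by (simp flip: powr_add mult.assoc)
  qed
  have powmeas: "(\<lambda>x::'a. norm x powr c) \<in> borel_measurable lebesgue" for c
    by (intro borel_measurable_off_origin continuous_intros) auto
  have meas: "(\<lambda>x. norm x powr (- b2) * u2 x) \<in> borel_measurable lebesgue"
    by (intro borel_measurable_times powmeas u2)
  have Lp1: "in_Lp p (\<lambda>x. norm x powr (- b1) * u1 x)"
    using space by (simp add: CKN_space_def p)
  have Lp2: "in_Lp p (\<lambda>x. norm x powr (- b2) * u2 x)"
    unfolding in_Lp_def
  proof
    have "integrable lebesgue (\<lambda>x. norm (norm x powr (- b2) * u2 x) powr p)
        \<longleftrightarrow> integrable lebesgue (\<lambda>x. norm (norm x powr (- b1) * u1 x) powr p)"
    proof (rule integrable_cong_AE)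
      show "AE x in lebesgue. norm (norm x powr (- b2) * u2 x) powr p
          = norm (norm x powr (- b1) * u1 x) powr p"
        using w by eventually_elim simp
    qed (use meas Lp1 in \<open>auto simp: in_Lp_def\<close>)
    then show "integrable lebesgue (\<lambda>x. norm (norm x powr (- b2) * u2 x) powr p)"
      using Lp1 by (simp add: in_Lp_def)
  qed (rule meas)
  have "integrable lebesgue (\<lambda>x. \<bar>norm x powr (- b2) * v2 x\<bar> powr p)"
  proof -
    have "v2 \<in> borel_measurable lebesgue"
      by (rule borel_measurable_off_origin[OF Ck_on_imp_continuous[OF v2]])
    then have "(\<lambda>x. norm x powr (- b2) * v2 x) \<in> borel_measurable lebesgue"
      by (intro borel_measurable_times powmeas)
    moreover have "AE x in lebesgue. \<bar>norm x powr (- b2) * v2 x\<bar> powr p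
        = \<bar>norm x powr (- b2) * u2 x\<bar> powr p"
      using u2v2 by eventually_elim simp
    ultimately show ?thesis
      using Lp2 meas by (subst integrable_cong_AE[where g = "\<lambda>x. \<bar>norm x powr (- b2) * u2 x\<bar> powr p"])
        (auto simp: in_Lp_def)
  qed
  then have energy: "integrable lebesgue (\<lambda>x. norm x powr (- 2 * a2) * (norm (grad v2 x))\<^sup>2)"
    using pos ba b by (intro weighted_gradient_integrable[OF v2 eq2 _ _ _ p2]) auto
  have contgrad: "continuous_on (- {0}) (grad v2)"
    unfolding grad_def using v2' by (intro continuous_intros) (simp add: eval_nat_numeral)
  have "in_Lp 2 (\<lambda>x. norm x powr (- a2) *\<^sub>R grad v2 x)"
    unfolding in_Lp_def
  proof
    show "(\<lambda>x. norm x powr (- a2) *\<^sub>R grad v2 x) \<in> borel_measurable lebesgue"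
      using contgrad by (intro borel_measurable_off_origin) (auto intro!: continuous_intros)
    have "norm (norm x powr (- a2) *\<^sub>R grad v2 x) powr 2
        = norm x powr (- 2 * a2) * (norm (grad v2 x))\<^sup>2" for x
      by (simp add: power_mult_distrib power2_eq_square flip: powr_add)
    then show "integrable lebesgue (\<lambda>x. norm (norm x powr (- a2) *\<^sub>R grad v2 x) powr 2)"
      using energy by simp
  qed
  moreover have "weak_gradient_on (- {0}) u2 (grad v2)"
    using u2v2 by (intro classical_gradient_is_weak v2' u2) (auto elim: AE_mp)
  ultimately have "u2 \<in> CKN_space a2 b2"
    using Lp2 unfolding CKN_space_def p2 by blast
  moreover have "CKN_solution a2 b2 p u2"
    unfolding CKN_solution_def using u2v2 v2 eq2 by blast
  ultimately show ?thesis ..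
qed

theorem theorem1p1:
  fixes u1 u2 :: "real ^ 'n \<Rightarrow> real"
    and N :: nat
    and a_c a1 a2 b1 b2 p1 p2 :: real
  assumes "N = CARD('n)" and "N \<ge> 2"
    and "a_c = (real N - 2) / 2"
    and "N \<ge> 3 \<Longrightarrow> b1 \<in> {a1..a1 + 1}" and "N = 2 \<Longrightarrow> b1 \<in> {a1<..a1 + 1}"
    and "N \<ge> 3 \<Longrightarrow> b2 \<in> {a2..a2 + 1}" and "N = 2 \<Longrightarrow> b2 \<in> {a2<..a2 + 1}"
    and "p1 = CKN_exponent N a1 b1" and "p2 = CKN_exponent N a2 b2"
    and "a1 + a2 = 2 * a_c" and "b2 - a2 = b1 - a1"
    and "u1 \<in> borel_measurable lebesgue" and "u2 \<in> borel_measurable lebesgue"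
    and "AE x in lebesgue. u1 x \<ge> 0" and "AE x in lebesgue. u2 x \<ge> 0"
    and "AE x in lebesgue. norm x powr (- a1) * u1 x = norm x powr (- a2) * u2 x"
  shows "u1 \<in> CKN_space a1 b1 \<and> CKN_solution a1 b1 p1 u1
     \<longleftrightarrow> u2 \<in> CKN_space a2 b2 \<and> CKN_solution a2 b2 p2 u2"
proof -
  have N: "N = DIM(real ^ 'n)" using assms(1) by simp
  have "N = 2 \<or> N \<ge> 3" using assms(2) by linarith
  then have pos: "0 < real N - 2 + 2 * (b1 - a1)" and ba: "b1 - a1 \<le> 1"
    using assms(4,5) by auto
  have a: "a1 + a2 = real N - 2" using assms(3,10) by simp
  have p: "p2 = p1" using assms(8,9,11) by (simp add: CKN_exponent_def)
  have "u2 \<in> CKN_space a2 b2 \<and> CKN_solution a2 b2 p1 u2"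
    if "u1 \<in> CKN_space a1 b1 \<and> CKN_solution a1 b1 p1 u1"
    using CKN_solution_power_weight[of b1 a1 a2 b2 p1 u2 u1] pos ba a assms(8,11,13,16) that unfolding N by blast
  moreover have "u1 \<in> CKN_space a1 b1 \<and> CKN_solution a1 b1 p1 u1"
    if "u2 \<in> CKN_space a2 b2 \<and> CKN_solution a2 b2 p1 u2"
  proof (rule CKN_solution_power_weight[of b2 a2 a1 b1 p1 u1 u2])
    show "AE x in lebesgue. norm x powr (- a2) * u2 x = norm x powr (- a1) * u1 x"
      using assms(16) by eventually_elim simp
  qed (use pos ba a assms(9,11,12) p that N in auto)
  ultimately show ?thesis unfolding p by blast
qed

end
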